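(* For every integer $l \geq 3$, $\sigma^{-}(P(2l+1,2)) = 7$.
   Context: For $n \geq 3$, $k \geq 1$ with $2k<n$, the generalized Petersen graph $P(n,k)$ has vertex set $\{u_i, v_i : i=0,1,\dots,n-1\}$ and edge set $\{u_iu_{i+1},\ u_iv_i,\ v_iv_{i+k} : i=0,\dots,n-1\}$, subscripts read modulo $n$. For a simple connected graph $G$ of order $N$, the \textbf{rna} number $\sigma^{-}(G)$ is the minimum, over all bijections $f: V(G)\to\{1,2,\dots,N\}$, of the number of edges $uv$ of $G$ such that $f(u)$ and $f(v)$ have different parity. *)

theory Defs
  imports Main
begin

text \<open>
  An undirected graph is given by its vertex set \<open>V\<close> and its edge set \<open>E\<close>, each edge being the
  two-element set of its end points.
\<close>

definition parity_cut :: "('a \<Rightarrow> nat) \<Rightarrow> 'a set set \<Rightarrow> 'a set set" where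
  "parity_cut f E = {e \<in> E. \<exists>x y. e = {x, y} \<and> even (f x) \<noteq> even (f y)}"

text \<open>
  For finite \<open>V\<close> and \<open>E\<close> the minimum ranges over a finite nonempty set: each value is at most
  \<open>card E\<close>.
\<close>

definition rna_number :: "'a set \<Rightarrow> 'a set set \<Rightarrow> nat" where
  "rna_number V E = Min {card (parity_cut f E) | f. bij_betw f V {1..card V}}"

datatype gp_vertex = Outer nat | Inner nat

text \<open>
  \<open>Outer i\<close> is $u_i$ and \<open>Inner i\<close> is $v_i$.  The intended parameters are
  \<open>n \<ge> 3\<close>, \<open>k \<ge> 1\<close> and \<open>2 * k < n\<close>; then all edges below have two distinct end points.
\<close>

definition gp_vertices :: "nat \<Rightarrow> gp_vertex set" where
  "gp_vertices n = Outer ` {0..<n} \<union> Inner ` {0..<n}"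

definition gp_edges :: "nat \<Rightarrow> nat \<Rightarrow> gp_vertex set set" where
  "gp_edges n k =
     (\<Union>i\<in>{0..<n}. {{Outer i, Outer ((i + 1) mod n)},
                    {Outer i, Inner i},
                    {Inner i, Inner ((i + k) mod n)}})"

lemma gp_edges_wf:
  assumes "n \<ge> 3" "k \<ge> 1" "2 * k < n" "e \<in> gp_edges n k"
  shows "e \<subseteq> gp_vertices n" "card e = 2"
proof -
  have ne: "(i + j) mod n \<noteq> i" if "i < n" "0 < j" "j < n" for i j
    using that by (cases "i + j < n") (simp_all add: le_mod_geq)
  show "e \<subseteq> gp_vertices n"
    using assms by (auto simp: gp_edges_def gp_vertices_def)
  show "card e = 2"
  proof -
    from assms(4) obtain i where i: "i < n"
      and e: "e = {Outer i, Outer ((i + 1) mod n)} \<or> e = {Outer i, Inner i}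
              \<or> e = {Inner i, Inner ((i + k) mod n)}"
      unfolding gp_edges_def by auto
    have "(i + 1) mod n \<noteq> i" "(i + k) mod n \<noteq> i"
      using ne[OF i, of 1] ne[OF i, of k] assms(1-3) by auto
    then show ?thesis
      using e by (elim disjE) (simp_all add: eq_commute[of i])
  qed
qed

lemma rna_number_attained:
  assumes "finite V" "finite E"
  shows "\<exists>f. bij_betw f V {1..card V} \<and> rna_number V E = card (parity_cut f E)"
    and "bij_betw f V {1..card V} \<Longrightarrow> rna_number V E \<le> card (parity_cut f E)"
proof -
  let ?S = "{card (parity_cut f E) | f. bij_betw f V {1..card V}}"
  have "?S \<subseteq> {..card E}"
    using assms(2) by (auto simp: parity_cut_def intro!: card_mono)
  then have fin: "finite ?S"
    using finite_subset by blast
  have "?S \<noteq> {}"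
    using finite_same_card_bij[OF assms(1), of "{1..card V}"] by auto
  then have "Min ?S \<in> ?S"
    using fin by (rule Min_in[rotated])
  then show "\<exists>f. bij_betw f V {1..card V} \<and> rna_number V E = card (parity_cut f E)"
    unfolding rna_number_def by blast
  show "rna_number V E \<le> card (parity_cut f E)" if "bij_betw f V {1..card V}"
    unfolding rna_number_def using fin that by (intro Min_le) auto
qed

end

theory Submission
  imports Defs
begin

text \<open>
  With \<open>n = 2 * l + 1\<close>, a labelling splits the vertices into two classes of size \<open>n\<close>.  Outer and
  inner vertices each form an \<open>n\<close>-cycle (the inner one because \<open>n\<close> is odd), so the numbers \<open>o\<close> and
  \<open>t\<close> of cut outer and inner edges are even, while the number \<open>s\<close> of cut spokes is odd because the
  even class has odd size.  If \<open>o = 0\<close> or \<open>t = 0\<close>, one cycle is monochromatic, balance makes the other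
  one monochromatic of the opposite colour, and \<open>s = n \<ge> 7\<close>.  Otherwise a cut below 7 forces
  \<open>o = t = 2\<close> and \<open>s = 1\<close>: the outer colouring consists of two arcs, the inner colouring differs from
  it in one position, and by balance this position lies in the longer arc, of length \<open>l + 1 \<ge> 4\<close>.
  Without the flip four inner edges cross the two arc ends, and their end points in the longer arc
  are distinct, so the flip repairs at most one of them and \<open>t \<ge> 3\<close>, a contradiction.
  The value 7 is attained by the class \<open>u\<^sub>0, \<dots>, u\<^sub>l, v\<^sub>0, \<dots>, v\<^sub>l\<^sub>-\<^sub>1\<close>.

  Below, a colouring of a cycle is an \<open>n\<close>-periodic predicate on \<open>nat\<close>, which makes rotations mere
  index shifts.
\<close>

definition count_below :: "nat \<Rightarrow> (nat \<Rightarrow> bool) \<Rightarrow> nat" where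
  "count_below n P = card {i. i < n \<and> P i}"

lemma count_below_sum: "count_below n P = (\<Sum>i<n. if P i then 1 else 0)"
proof -
  have "{i. i < n \<and> P i} = {i \<in> {..<n}. P i}" by auto
  then show ?thesis by (simp add: count_below_def sum.If_cases Int_def)
qed

lemma count_below_eq_0: "count_below n P = 0 \<longleftrightarrow> (\<forall>i<n. \<not> P i)"
  by (auto simp: count_below_def)

lemma count_below_shift:
  assumes "\<And>i. P (i + n) = P i"
  shows "count_below n (\<lambda>i. P (i + s)) = count_below n P"
proof (induction s)
  case 0
  show ?case by simp
next
  case (Suc s)
  let ?f = "\<lambda>i. if P (i + s) then 1 else 0 :: nat"
  have "(\<Sum>i<Suc n. ?f i) = ?f 0 + (\<Sum>i<n. ?f (Suc i))"
    by (rule sum.lessThan_Suc_shift)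
  moreover have "?f n = ?f 0"
    using assms[of s] by (simp add: add.commute)
  ultimately have "(\<Sum>i<n. ?f (Suc i)) = (\<Sum>i<n. ?f i)"
    by simp
  then show ?case
    using Suc by (simp add: count_below_sum)
qed

lemma count_below_neq:
  "count_below n (\<lambda>i. P i \<noteq> Q i) + 2 * count_below n (\<lambda>i. P i \<and> Q i)
     = count_below n P + count_below n Q"
  unfolding count_below_sum sum_distrib_left sum.distrib[symmetric]
  by (intro sum.cong) auto

lemma even_count_below_periodic_change:
  fixes P :: "nat \<Rightarrow> bool"
  assumes "\<And>i. P (i + n) = P i"
  shows "even (count_below n (\<lambda>i. P i \<noteq> P (i + s)))"
proof -
  have "even (count_below n (\<lambda>i. P i \<noteq> P (i + s)) + 2 * count_below n (\<lambda>i. P i \<and> P (i + s)))"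
    unfolding count_below_neq count_below_shift[of P n s, OF assms] by simp
  then show ?thesis by simp
qed

lemma count_below_neq_constant:
  assumes "\<And>i. i < n \<Longrightarrow> P i = x" "count_below n P + count_below n Q = n"
  shows "count_below n (\<lambda>i. P i \<noteq> Q i) = n"
proof -
  have "count_below n (\<lambda>i. P i \<and> Q i) = 0"
  proof (cases x)
    case True
    then have "count_below n P = n"
      using assms(1) by (simp add: count_below_sum)
    then have "count_below n Q = 0" using assms(2) by simp
    then show ?thesis by (simp add: count_below_eq_0)
  next
    case False
    then show ?thesis using assms(1) by (simp add: count_below_eq_0)
  qed
  then show ?thesis
    using count_below_neq[of n P Q] assms(2) by simp
qed

lemma change_by_2_normalized:
  fixes c d :: "nat \<Rightarrow> bool"
  assumes n: "n = 2 * l + 1" "l \<ge> 3"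
    and per: "\<And>i. c (i + n) = c i" "\<And>i. d (i + n) = d i"
    and two: "count_below n (\<lambda>i. c i \<noteq> c (i + 1)) = 2"
    and j: "j < n" "\<And>i. i < n \<Longrightarrow> c i \<noteq> d i \<longleftrightarrow> i = j"
    and start: "\<And>i. i \<le> j \<Longrightarrow> c i = c 0" "c (n - 1) \<noteq> c 0"
    and bal: "count_below n c + count_below n d = n"
  shows "count_below n (\<lambda>i. d i \<noteq> d (i + 2)) \<ge> 3"
proof -
  define m where "m = (LEAST i. c i \<noteq> c 0)"
  have m: "c m \<noteq> c 0" and mle: "m \<le> n - 1"
    using LeastI[of "\<lambda>i. c i \<noteq> c 0" "n - 1"] Least_le[of "\<lambda>i. c i \<noteq> c 0" "n - 1"] start(2)
    unfolding m_def by blast+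
  have below: "c i = c 0" if "i < m" for i
    using not_less_Least[of i "\<lambda>i. c i \<noteq> c 0"] that by (auto simp: m_def)
  have jm: "j < m" using start(1)[of m] m by (meson not_le)
  define B where "B = {i. i < n \<and> c i \<noteq> c (i + 1)}"
  have "c n = c 0" using per(1)[of 0] by simp
  then have "n - 1 \<in> B" using start(2) n by (auto simp: B_def)
  moreover have "m - 1 \<in> B" using below[of "m - 1"] m jm mle n by (auto simp: B_def)
  moreover have "card B = 2" using two by (simp add: B_def count_below_def)
  moreover have "finite B" by (simp add: B_def)
  ultimately have B: "B = {m - 1, n - 1}"
    using jm mle n by (intro card_subset_eq[symmetric]) auto
  have c_Suc: "c (Suc i) = c i" if "m \<le> i" "i < n - 1" for i
  proof -
    have "i \<notin> B" using B that jm by auto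
    then show ?thesis using that by (auto simp: B_def)
  qed
  have above: "c i \<noteq> c 0" if "m \<le> i" "i < n" for i
    using that(1,2)
  proof (induction rule: dec_induct)
    case base
    show ?case by (rule m)
  next
    case (step k)
    then show ?case using c_Suc[of k] by auto
  qed
  have c_iff: "c i = c 0 \<longleftrightarrow> i < m" if "i < n" for i
    using above[of i] below[of i] that by (meson not_le)
  have d_iff: "d i = c 0 \<longleftrightarrow> i < m \<and> i \<noteq> j" if "i < n" for i
    using c_iff[OF that] j(2)[OF that] jm by auto
  have "2 * m - 1 = n"
  proof (cases "c 0")
    case True
    have "{i. i < n \<and> c i} = {..<m}" "{i. i < n \<and> d i} = {..<m} - {j}"
      using True c_iff d_iff mle n by auto
    then show ?thesis using bal jm by (auto simp: count_below_def)
  next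
    case False
    have "{i. i < n \<and> c i} = {m..<n}" "{i. i < n \<and> d i} = insert j {m..<n}"
      using False c_iff d_iff jm j(1) by (auto simp: not_less) (meson not_le)+
    then have "(n - m) + Suc (n - m) = n" using bal jm by (simp add: count_below_def)
    then show ?thesis using mle n by auto
  qed
  then have ml: "m = l + 1" using n by auto
  define T where "T = {i. i < n \<and> d i \<noteq> d (i + 2)}"
  have fin: "finite T" by (simp add: T_def)
  have dn: "d n = d 0" "d (Suc n) = d 1" using per(2)[of 0] per(2)[of 1] by simp_all
  have T: "i \<in> T" if "i < n" "(d i = c 0) \<noteq> (d (i + 2) = c 0)" for i
    using that by (auto simp: T_def)
  have T1: "n - 2 \<in> T" if "j \<noteq> 0"
  proof (rule T)
    have "n - 2 + 2 = n" "n - 2 < n" "\<not> n - 2 < m" "0 < m" using n ml by auto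
    then show "(d (n - 2) = c 0) \<noteq> (d (n - 2 + 2) = c 0)"
      using d_iff[of "n - 2"] d_iff[of 0] dn that n by simp
  qed (use n in simp)
  have T2: "n - 1 \<in> T" if "j \<noteq> 1"
  proof (rule T)
    have "n - 1 + 2 = Suc n" "n - 1 < n" "\<not> n - 1 < m" "1 < m" using n ml by auto
    then show "(d (n - 1) = c 0) \<noteq> (d (n - 1 + 2) = c 0)"
      using d_iff[of "n - 1"] d_iff[of 1] dn that n by simp
  qed (use n in simp)
  have T3: "l - 1 \<in> T" if "j \<noteq> l - 1"
  proof (rule T)
    have "l - 1 + 2 = l + 1" using n by simp
    then show "(d (l - 1) = c 0) \<noteq> (d (l - 1 + 2) = c 0)"
      using d_iff[of "l - 1"] d_iff[of "l + 1"] that n ml by simp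
  qed (use n in simp)
  have T4: "l \<in> T" if "j \<noteq> l"
    using d_iff[of l] d_iff[of "l + 2"] that n ml by (intro T) simp_all
  have three: "card T \<ge> 3" if "{x, y, z} \<subseteq> T" "x \<noteq> y" "y \<noteq> z" "x \<noteq> z" for x y z
    using card_mono[OF fin that(1)] that(2-4) by simp
  have "card T \<ge> 3"
  proof -
    consider "j = 0" | "j = 1" | "j \<noteq> 0" "j \<noteq> 1" "j \<noteq> l" | "j = l" by blast
    then show ?thesis
    proof cases
      case 1
      then show ?thesis using T2 T3 T4 n by (intro three[of "n - 1" "l - 1" l]) auto
    next
      case 2
      then show ?thesis using T1 T3 T4 n by (intro three[of "n - 2" "l - 1" l]) auto
    next
      case 3
      then show ?thesis using T1 T2 T4 n by (intro three[of "n - 2" "n - 1" l]) auto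
    next
      case 4
      then show ?thesis using T1 T2 T3 n by (intro three[of "n - 2" "n - 1" "l - 1"]) auto
    qed
  qed
  then show ?thesis by (simp add: T_def count_below_def)
qed

lemma change_by_2_ge_3:
  fixes a b :: "nat \<Rightarrow> bool"
  assumes n: "n = 2 * l + 1" "l \<ge> 3"
    and per: "\<And>i. a (i + n) = a i" "\<And>i. b (i + n) = b i"
    and two: "count_below n (\<lambda>i. a i \<noteq> a (i + 1)) = 2"
    and one: "count_below n (\<lambda>i. a i \<noteq> b i) = 1"
    and bal: "count_below n a + count_below n b = n"
  shows "count_below n (\<lambda>i. b i \<noteq> b (i + 2)) \<ge> 3"
proof -
  obtain j where "{i. i < n \<and> a i \<noteq> b i} = {j}"
    using one unfolding count_below_def by (rule card_1_singletonE)
  then have j: "j < n" "a j \<noteq> b j" by auto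
  \<comment> \<open>Rotate so that the arc containing the flipped position starts at 0.\<close>
  define S where "S = {i. i < j + n \<and> a i \<noteq> a j}"
  define p where "p = Max S"
  have fin: "finite S" by (simp add: S_def)
  have "S \<noteq> {}"
  proof
    assume "S = {}"
    then have const: "a i = a j" if "i < j + n" for i using that by (auto simp: S_def)
    have "a i = a (i + 1)" if "i < n" for i
    proof (cases "i + 1 = n")
      case True
      then show ?thesis using const[of i] const[of 0] that per(1)[of 0] by simp
    next
      case False
      then show ?thesis using const[of i] const[of "i + 1"] that by simp
    qed
    then have "count_below n (\<lambda>i. a i \<noteq> a (i + 1)) = 0"
      unfolding count_below_eq_0 by blast
    then show False using two by simp
  qed
  then have "p \<in> S" using Max_in[OF fin] by (simp add: p_def)
  then have p: "p < j + n" "a p \<noteq> a j" by (auto simp: S_def)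
  have last: "a i = a j" if "p < i" "i < j + n" for i
  proof (rule ccontr)
    assume "a i \<noteq> a j"
    then have "i \<in> S" using that by (simp add: S_def)
    then have "i \<le> p" using Max_ge[OF fin] by (simp add: p_def)
    then show False using that by simp
  qed
  have jp: "j \<le> p"
    using last[of "p + n"] per(1)[of p] p n by (cases "j \<le> p") auto
  define s where "s = p + 1"
  define k where "k = j + n - s"
  have ks: "k + s = j + n" using p by (simp add: k_def s_def)
  have k: "k < n" using jp p by (auto simp: k_def s_def)
  define c where "c i = a (i + s)" for i
  define d where "d i = b (i + s)" for i
  have cper: "c (i + n) = c i" and dper: "d (i + n) = d i" for i
    using per(1)[of "i + s"] per(2)[of "i + s"] by (simp_all add: c_def d_def ac_simps)
  have ck: "c k = a j" "d k = b j" using per ks by (simp_all add: c_def d_def)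
  have start: "c i = a j" if "i \<le> k" for i
  proof (cases "i = k")
    case False
    then have "i + s < j + n" using that ks by simp
    then show ?thesis using last[of "i + s"] by (simp add: c_def s_def)
  qed (simp add: ck)
  have "n - 1 + s = p + n" using n by (simp add: s_def)
  then have cend: "c (n - 1) = a p" using per(1) by (simp add: c_def)
  have shift: "count_below n c = count_below n a" "count_below n d = count_below n b"
    "count_below n (\<lambda>i. c i \<noteq> d i) = count_below n (\<lambda>i. a i \<noteq> b i)"
    "count_below n (\<lambda>i. c i \<noteq> c (i + 1)) = count_below n (\<lambda>i. a i \<noteq> a (i + 1))"
    "count_below n (\<lambda>i. d i \<noteq> d (i + 2)) = count_below n (\<lambda>i. b i \<noteq> b (i + 2))"
    using count_below_shift[of a n s] count_below_shift[of b n s]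
      count_below_shift[of "\<lambda>i. a i \<noteq> b i" n s]
      count_below_shift[of "\<lambda>i. a i \<noteq> a (i + 1)" n s]
      count_below_shift[of "\<lambda>i. b i \<noteq> b (i + 2)" n s] per per(1)[of "_ + 1"] per(2)[of "_ + 2"]
    by (simp_all add: c_def[abs_def] d_def[abs_def] ac_simps)
  obtain k' where k': "{i. i < n \<and> c i \<noteq> d i} = {k'}"
    using one shift(3) unfolding count_below_def by (metis card_1_singletonE)
  moreover have "k \<in> {i. i < n \<and> c i \<noteq> d i}" using k ck j by simp
  ultimately have "{i. i < n \<and> c i \<noteq> d i} = {k}" by simp
  then have cd: "c i \<noteq> d i \<longleftrightarrow> i = k" if "i < n" for i using that by auto
  have "count_below n (\<lambda>i. d i \<noteq> d (i + 2)) \<ge> 3"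
    using change_by_2_normalized[OF n cper dper _ k cd] start start[of 0] cend p shift two bal
    by simp
  then show ?thesis using shift(5) by simp
qed

lemma periodic_cut_ge_7:
  fixes a b :: "nat \<Rightarrow> bool"
  assumes n: "n = 2 * l + 1" "l \<ge> 3"
    and per: "\<And>i. a (i + n) = a i" "\<And>i. b (i + n) = b i"
    and bal: "count_below n a + count_below n b = n"
  shows "count_below n (\<lambda>i. a i \<noteq> a (i + 1)) + count_below n (\<lambda>i. a i \<noteq> b i)
           + count_below n (\<lambda>i. b i \<noteq> b (i + 2)) \<ge> 7" (is "?o + ?s + ?t \<ge> 7")
proof -
  have ev: "even ?o" "even ?t"
    using even_count_below_periodic_change[of a n 1] even_count_below_periodic_change[of b n 2] per
    by simp_all
  have "odd (?s + 2 * count_below n (\<lambda>i. a i \<and> b i))"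
    unfolding count_below_neq bal using n(1) by simp
  then have od: "odd ?s" by simp
  have ge_even: "x = 2 \<or> x \<ge> 4" if "even x" "x \<noteq> 0" for x :: nat
    using that by presburger
  have ge_odd: "x = 1 \<or> x \<ge> 3" if "odd x" for x :: nat
    using that by presburger
  have neq: "count_below n (\<lambda>i. b i \<noteq> a i) = ?s" by (simp add: eq_commute)
  show ?thesis
  proof (cases "?o = 0 \<or> ?t = 0")
    case True
    then have "?s = n"
    proof
      assume "?o = 0"
      then have step: "a (Suc i) = a i" if "i < n" for i
        using that by (simp add: count_below_eq_0)
      have "a i = a 0" if "i < n" for i
        using that by (induction i) (use step in auto)
      then show ?thesis using bal by (rule count_below_neq_constant)
    next
      assume "?t = 0"
      then have "count_below n (\<lambda>i. b (i + s) \<noteq> b (i + s + 2)) = 0" for s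
        using count_below_shift[of "\<lambda>i. b i \<noteq> b (i + 2)" n s] per(2) per(2)[of "_ + 2"]
        by (simp add: ac_simps)
      then have step: "b (s + 2) = b s" for s
        using n unfolding count_below_eq_0 by (metis add_0 add_gr_0 zero_less_one)
      have ev0: "b (2 * i) = b 0" for i
        by (induction i) (use step in \<open>auto simp: algebra_simps\<close>)
      have "b i = b 0" for i
      proof (cases "even i")
        case True
        then show ?thesis using ev0 by (auto elim: evenE)
      next
        case False
        then have "even (i + n)" using n by simp
        then have "b (i + n) = b 0" using ev0 by (metis evenE)
        then show ?thesis using per(2) by simp
      qed
      then show ?thesis
        using count_below_neq_constant[of n b "b 0" a] bal neq by (simp add: add.commute)
    qed
    then show ?thesis using n by simp
  next
    case False
    have "\<not> (?o = 2 \<and> ?s = 1 \<and> ?t = 2)"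
      using change_by_2_ge_3[OF n per _ _ bal] by force
    moreover have "?o = 2 \<or> ?o \<ge> 4" "?t = 2 \<or> ?t \<ge> 4" "?s = 1 \<or> ?s \<ge> 3"
      using False ev od ge_even ge_odd by blast+
    ultimately show ?thesis by linarith
  qed
qed

lemma parity_cut_pair:
  "{x, y} \<in> parity_cut f E \<longleftrightarrow> {x, y} \<in> E \<and> even (f x) \<noteq> even (f y)"
  by (auto simp: parity_cut_def doubleton_eq_iff)

lemma mod_add_less:
  fixes i k n :: nat
  assumes "i < n" "k \<le> n"
  shows "(i + k) mod n = (if i + k < n then i + k else i + k - n)"
  using assms by (simp add: le_mod_geq)

lemma inj_on_cyclic_pairs:
  fixes k n :: nat
  assumes "0 < k" "2 * k < n" "inj g"
  shows "inj_on (\<lambda>i. {g i, g ((i + k) mod n)}) {..<n}"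
proof (rule inj_onI)
  fix i j
  assume ij: "i \<in> {..<n}" "j \<in> {..<n}"
    and eq: "{g i, g ((i + k) mod n)} = {g j, g ((j + k) mod n)}"
  have wrap: "(i + k) mod n = i + k \<or> (i + k) mod n + n = i + k"
    "(j + k) mod n = j + k \<or> (j + k) mod n + n = j + k"
    using ij assms(2) by (simp_all add: mod_add_less)
  show "i = j"
  proof (rule ccontr)
    assume "i \<noteq> j"
    then have "i = (j + k) mod n" "j = (i + k) mod n"
      using eq assms(3) by (auto simp: doubleton_eq_iff inj_eq)
    then have "j = i + k \<or> j + n = i + k" "i = j + k \<or> i + n = j + k"
      using wrap by metis+
    then show False
      using ij assms(1,2) unfolding lessThan_iff by linarith
  qed
qed

lemma card_parity_cut_gp:
  fixes f :: "gp_vertex \<Rightarrow> nat"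
  assumes "0 < k" "2 * k < n"
  defines "a \<equiv> \<lambda>i. even (f (Outer (i mod n)))"
    and "b \<equiv> \<lambda>i. even (f (Inner (i mod n)))"
  shows "card (parity_cut f (gp_edges n k)) = count_below n (\<lambda>i. a i \<noteq> a (i + 1))
           + count_below n (\<lambda>i. a i \<noteq> b i) + count_below n (\<lambda>i. b i \<noteq> b (i + k))"
proof -
  let ?X = "{i. i < n \<and> a i \<noteq> a (i + 1)}"
  let ?Y = "{i. i < n \<and> a i \<noteq> b i}"
  let ?Z = "{i. i < n \<and> b i \<noteq> b (i + k)}"
  let ?x = "\<lambda>i. {Outer i, Outer ((i + 1) mod n)}"
  let ?y = "\<lambda>i. {Outer i, Inner i}"
  let ?z = "\<lambda>i. {Inner i, Inner ((i + k) mod n)}"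
  have E: "gp_edges n k = ?x ` {..<n} \<union> ?y ` {..<n} \<union> ?z ` {..<n}"
    unfolding gp_edges_def atLeast0LessThan by blast
  have X: "?x i \<in> parity_cut f (gp_edges n k) \<longleftrightarrow> i \<in> ?X" if "i < n" for i
    using that E by (auto simp: parity_cut_pair a_def)
  have Y: "?y i \<in> parity_cut f (gp_edges n k) \<longleftrightarrow> i \<in> ?Y" if "i < n" for i
    using that E by (auto simp: parity_cut_pair a_def b_def)
  have Z: "?z i \<in> parity_cut f (gp_edges n k) \<longleftrightarrow> i \<in> ?Z" if "i < n" for i
    using that E by (auto simp: parity_cut_pair b_def)
  have sub: "parity_cut f (gp_edges n k) \<subseteq> ?x ` {..<n} \<union> ?y ` {..<n} \<union> ?z ` {..<n}"
    unfolding E by (auto simp: parity_cut_def)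
  have cut: "parity_cut f (gp_edges n k) = ?x ` ?X \<union> ?y ` ?Y \<union> ?z ` ?Z"
  proof (intro equalityI subsetI)
    fix e assume e: "e \<in> parity_cut f (gp_edges n k)"
    then consider i where "i < n" "e = ?x i" | i where "i < n" "e = ?y i"
      | i where "i < n" "e = ?z i"
      using sub by blast
    then show "e \<in> ?x ` ?X \<union> ?y ` ?Y \<union> ?z ` ?Z"
      by cases (use e X Y Z in blast)+
  next
    fix e assume "e \<in> ?x ` ?X \<union> ?y ` ?Y \<union> ?z ` ?Z"
    then consider i where "i \<in> ?X" "e = ?x i" | i where "i \<in> ?Y" "e = ?y i"
      | i where "i \<in> ?Z" "e = ?z i"
      by blast
    then show "e \<in> parity_cut f (gp_edges n k)"
      by cases (use X Y Z in blast)+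
  qed
  have inj: "inj_on ?x ?X" "inj_on ?y ?Y" "inj_on ?z ?Z"
    using inj_on_cyclic_pairs[of 1 n Outer] inj_on_cyclic_pairs[of k n Inner] assms(1,2)
    by (auto simp: inj_on_def doubleton_eq_iff)
  have "card (parity_cut f (gp_edges n k)) = card (?x ` ?X) + card (?y ` ?Y) + card (?z ` ?Z)"
    unfolding cut by (subst card_Un_disjoint; (subst card_Un_disjoint)?) (auto simp: doubleton_eq_iff)
  then show ?thesis
    by (simp only: card_image[OF inj(1)] card_image[OF inj(2)] card_image[OF inj(3)] count_below_def)
qed

lemma card_gp_vertices: "card (gp_vertices n) = 2 * n"
  unfolding gp_vertices_def
  by (subst card_Un_disjoint) (auto simp: card_image inj_on_def)

lemma finite_gp_vertices: "finite (gp_vertices n)"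
  by (simp add: gp_vertices_def)

lemma finite_gp_edges: "finite (gp_edges n k)"
  by (simp add: gp_edges_def)

lemma card_even_upto: "card {i \<in> {1..2 * n}. even i} = (n::nat)"
proof -
  have "{i \<in> {1..2 * n}. even i} = (*) 2 ` {1..n}" by (auto elim!: evenE)
  then show ?thesis by (simp add: card_image inj_on_def)
qed

lemma bij_betw_prescribed_even:
  assumes "finite V" "card V = 2 * n" "S \<subseteq> V" "card S = n"
  shows "\<exists>f. bij_betw f V {1..card V} \<and> (\<forall>x\<in>V. even (f x) \<longleftrightarrow> x \<in> S)"
proof -
  let ?E = "{i \<in> {1..2 * n}. even i}" and ?O = "{i \<in> {1..2 * n}. odd i}"
  have EO: "?E \<union> ?O = {1..2 * n}" "?E \<inter> ?O = {}" by auto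
  then have "card ?E + card ?O = 2 * n"
    using card_Un_disjoint[of ?E ?O] by simp
  then have "card ?O = n" using card_even_upto[of n] by simp
  moreover have fin: "finite S" using assms finite_subset by blast
  moreover have "card (V - S) = n" using assms fin by (simp add: card_Diff_subset)
  ultimately obtain g h where g: "bij_betw g S ?E" and h: "bij_betw h (V - S) ?O"
    using finite_same_card_bij[of S ?E] finite_same_card_bij[of "V - S" ?O] card_even_upto[of n] assms
    by auto
  let ?f = "\<lambda>x. if x \<in> S then g x else h x"
  have "bij_betw ?f (S \<union> (V - S)) (?E \<union> ?O)"
  proof (rule bij_betw_combine)
    show "bij_betw ?f S ?E" using g by (simp cong: bij_betw_cong)
    have "bij_betw ?f (V - S) ?O \<longleftrightarrow> bij_betw h (V - S) ?O" by (rule bij_betw_cong) simp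
    then show "bij_betw ?f (V - S) ?O" using h by simp
  qed (rule EO(2))
  moreover have "S \<union> (V - S) = V" using assms by blast
  ultimately have "bij_betw ?f V {1..card V}" using EO(1) assms by simp
  moreover have "even (?f x) \<longleftrightarrow> x \<in> S" if "x \<in> V" for x
    using bij_betwE[OF g] bij_betwE[OF h] that by auto
  ultimately show ?thesis by blast
qed

lemma count_below_even_labels:
  assumes "bij_betw f (gp_vertices n) {1..card (gp_vertices n)}"
  shows "count_below n (\<lambda>i. even (f (Outer (i mod n))))
           + count_below n (\<lambda>i. even (f (Inner (i mod n)))) = n"
proof -
  let ?A = "{i. i < n \<and> even (f (Outer i))}" and ?B = "{i. i < n \<and> even (f (Inner i))}"
  have b: "bij_betw f (gp_vertices n) {1..2 * n}" using assms by (simp add: card_gp_vertices)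
  let ?S = "{x \<in> gp_vertices n. even (f x)}"
  have "f ` ?S = {i \<in> {1..2 * n}. even i}"
    using b by (auto simp: bij_betw_def)
  moreover have "inj_on f ?S" using b by (auto simp: bij_betw_def inj_on_def)
  ultimately have "card ?S = n" using card_image[of f ?S] card_even_upto[of n] by simp
  moreover have "?S = Outer ` ?A \<union> Inner ` ?B" by (auto simp: gp_vertices_def)
  moreover have "card (Outer ` ?A \<union> Inner ` ?B) = card ?A + card ?B"
    by (subst card_Un_disjoint) (auto simp: card_image inj_on_def)
  moreover have "count_below n (\<lambda>i. even (f (Outer (i mod n)))) = card ?A"
    "count_below n (\<lambda>i. even (f (Inner (i mod n)))) = card ?B"
    by (auto simp: count_below_def intro!: arg_cong[where f = card])
  ultimately show ?thesis by simp
qed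

lemma gp_2_cut_7_attained:
  assumes n: "n = 2 * l + 1" "l \<ge> 3"
  shows "\<exists>f. bij_betw f (gp_vertices n) {1..card (gp_vertices n)}
           \<and> card (parity_cut f (gp_edges n 2)) = 7"
proof -
  let ?S = "Outer ` {..l} \<union> Inner ` {..<l}"
  have "card ?S = n"
    using n by (subst card_Un_disjoint) (auto simp: card_image inj_on_def)
  moreover have "?S \<subseteq> gp_vertices n" using n by (auto simp: gp_vertices_def)
  ultimately obtain f where f: "bij_betw f (gp_vertices n) {1..card (gp_vertices n)}"
    and ev: "\<forall>x\<in>gp_vertices n. even (f x) \<longleftrightarrow> x \<in> ?S"
    using bij_betw_prescribed_even[of "gp_vertices n" n ?S] card_gp_vertices finite_gp_vertices by auto
  have a: "even (f (Outer (i mod n))) \<longleftrightarrow> i mod n \<le> l"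
    and b: "even (f (Inner (i mod n))) \<longleftrightarrow> i mod n < l" for i
    using ev n by (auto simp: gp_vertices_def)
  have "{i. i < n \<and> (i mod n \<le> l) \<noteq> ((i + 1) mod n \<le> l)} = {l, 2 * l}"
    using n mod_add_less[of _ n 1] by (auto split: if_splits)
  moreover have "{i. i < n \<and> (i mod n \<le> l) \<noteq> (i mod n < l)} = {l}"
    using n by auto
  moreover have "{i. i < n \<and> (i mod n < l) \<noteq> ((i + 2) mod n < l)}
      = {l - 2, l - 1, 2 * l - 1, 2 * l}"
    using n mod_add_less[of _ n 2] by (auto split: if_splits)
  moreover have "card {l - 2, l - 1, 2 * l - 1, 2 * l} = 4"
    using n by (simp add: card_insert_if) linarith
  ultimately have "card (parity_cut f (gp_edges n 2)) = 7"
    using n card_parity_cut_gp[of 2 n f] unfolding a b count_below_def by simp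
  then show ?thesis using f by blast
qed

theorem theorem4p8:
  fixes l :: nat
  assumes "l \<ge> 3"
  shows "rna_number (gp_vertices (2 * l + 1)) (gp_edges (2 * l + 1) 2) = 7"
proof -
  define n where "n = 2 * l + 1"
  note attained = rna_number_attained[OF finite_gp_vertices[of n] finite_gp_edges[of n 2]]
  have "rna_number (gp_vertices n) (gp_edges n 2) \<le> 7"
    using gp_2_cut_7_attained[OF n_def assms] attained(2) by metis
  moreover have "rna_number (gp_vertices n) (gp_edges n 2) \<ge> 7"
  proof -
    obtain f where f: "bij_betw f (gp_vertices n) {1..card (gp_vertices n)}"
      and eq: "rna_number (gp_vertices n) (gp_edges n 2) = card (parity_cut f (gp_edges n 2))"
      using attained(1) by blast
    have "2 * 2 < n" using assms by (simp add: n_def)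
    then show ?thesis
      unfolding eq using periodic_cut_ge_7[OF n_def assms _ _ count_below_even_labels[OF f]]
      by (simp add: card_parity_cut_gp)
  qed
  ultimately show ?thesis by (simp add: n_def)
qed

end
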